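(* Let $\Omega\subset\mathbb R^n$ be a smooth bounded domain, let $V$ be a potential on $\Omega$ and let $K$ be a compact set included in $\Omega$. Assume that $C^2_c(\Omega\setminus K)$ is weakly dense in $C^2_0(\overline\Omega)$ in the sense of the potential $V$, and let $w\in L^1(\Omega;V)\cap L^1_0(\Omega)$ be such that for all $\varphi\in C^2_c(\Omega\setminus K)$ $$\int_\Omega w(-\Delta\varphi+V\varphi)\,dx=0.$$ Then the same equality holds for all $\varphi\in C^2_0(\overline\Omega)$.
   Context: A potential on $\Omega$ is a measurable function $V:\Omega\to[0,+\infty]$ that is not identically zero (a.e.). $C^2_0(\overline\Omega)=\{\varphi\in C^2(\overline\Omega):\ \varphi=0\text{ on }\partial\Omega\}$. With $\delta(x)=\mathrm{dist}(x;\partial\Omega)$, $$L^1(\Omega;V)=L^1(V)=\Big\{g:\Omega\to\mathbb R\text{ measurable}:\ \int_\Omega|g|V\,dx<+\infty\Big\},\qquad L^1_0(\Omega)=\Big\{g\in L^1(\Omega):\ \lim_{\varepsilon\to0}\frac1\varepsilon\int_{\{\delta\le\varepsilon\}}|g|\,dx=0\Big\}.$$ A sequence $(\varphi_j)_j$ of $C^2_0(\overline\Omega)$ converges weakly to $\phi\in C^2_0(\overline\Omega)$ in the sense of the potential $V$ if for all $g\in L^1(V)\cap L^1_0(\Omega)$, as $j\to+\infty$: $\int_\Omega g\varphi_jV\,dx\to\int_\Omega g\phi V\,dx$; $\int_\Omega g\,\partial_k\varphi_j\,dx\to\int_\Omega g\,\partial_k\phi\,dx$ for $k=1,\dots,n$;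 and $\int_\Omega g\Delta\varphi_j\,dx\to\int_\Omega g\Delta\phi\,dx$. $C^2_c(\Omega\setminus K)$ is weakly dense in $C^2_0(\overline\Omega)$ in the sense of $V$ if every $\phi\in C^2_0(\overline\Omega)$ is the weak limit, in the sense of $V$, of a sequence in $C^2_c(\Omega\setminus K)$. *)

theory Defs
  imports "HOL-Analysis.Analysis"
begin

definition partial_deriv :: "'n::finite \<Rightarrow> (real ^ 'n \<Rightarrow> real) \<Rightarrow> real ^ 'n \<Rightarrow> real" where
  "partial_deriv k f x = deriv (\<lambda>t. f (x + t *\<^sub>R axis k 1)) 0"

definition laplacian :: "(real ^ 'n::finite \<Rightarrow> real) \<Rightarrow> real ^ 'n \<Rightarrow> real" where
  "laplacian f x = (\<Sum>k\<in>UNIV. partial_deriv k (partial_deriv k f) x)"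

(* Intended for open U only. *)
primrec Ck_on :: "nat \<Rightarrow> (real ^ 'n::finite \<Rightarrow> real) \<Rightarrow> (real ^ 'n) set \<Rightarrow> bool" where
  "Ck_on 0 f U \<longleftrightarrow> continuous_on U f"
| "Ck_on (Suc m) f U \<longleftrightarrow>
     (\<forall>x\<in>U. f differentiable (at x)) \<and> (\<forall>k. Ck_on m (partial_deriv k f) U)"

(* The boundary is locally the graph of a C-infinity function of the other n-1 coordinates, with
   Omega on exactly one side of it. A function on R^(n-1) is encoded as a function on R^n that does
   not depend on the k-th coordinate; k and the sign s account for relabelling and reorienting
   the coordinate axes. *)
definition smooth_bounded_domain :: "(real ^ 'n::finite) set \<Rightarrow> bool" where
  "smooth_bounded_domain \<Omega> \<longleftrightarrow>
     open \<Omega> \<and> connected \<Omega> \<and> \<Omega> \<noteq> {} \<and> bounded \<Omega> \<and>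
     (\<forall>p\<in>frontier \<Omega>. \<exists>r>0. \<exists>k. \<exists>s\<in>{-1, 1}. \<exists>\<gamma>.
        (\<forall>m. Ck_on m \<gamma> UNIV) \<and>
        (\<forall>x t. \<gamma> (x + t *\<^sub>R axis k 1) = \<gamma> x) \<and>
        \<Omega> \<inter> ball p r = {x \<in> ball p r. s * x $ k > \<gamma> x})"

definition potential :: "(real ^ 'n::finite) set \<Rightarrow> (real ^ 'n \<Rightarrow> ennreal) \<Rightarrow> bool" where
  "potential \<Omega> V \<longleftrightarrow>
     V \<in> borel_measurable (lebesgue_on \<Omega>) \<and> \<not> (AE x in lebesgue_on \<Omega>. V x = 0)"

definition extends_continuously :: "(real ^ 'n::finite) set \<Rightarrow> (real ^ 'n \<Rightarrow> real) \<Rightarrow> bool" where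
  "extends_continuously \<Omega> f \<longleftrightarrow>
     (\<exists>h. continuous_on (closure \<Omega>) h \<and> (\<forall>x\<in>\<Omega>. h x = f x))"

definition C2_closure :: "(real ^ 'n::finite) set \<Rightarrow> (real ^ 'n \<Rightarrow> real) set" where
  "C2_closure \<Omega> = {\<phi>. Ck_on 2 \<phi> \<Omega> \<and> continuous_on (closure \<Omega>) \<phi> \<and>
     (\<forall>k. extends_continuously \<Omega> (partial_deriv k \<phi>)) \<and>
     (\<forall>k l. extends_continuously \<Omega> (partial_deriv k (partial_deriv l \<phi>)))}"

definition C2_0 :: "(real ^ 'n::finite) set \<Rightarrow> (real ^ 'n \<Rightarrow> real) set" where
  "C2_0 \<Omega> = {\<phi> \<in> C2_closure \<Omega>. \<forall>x\<in>frontier \<Omega>. \<phi> x = 0}"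

(* The support is taken in the whole space, so the elements are the C^2 functions with compact
   support in U together with their extension by zero. *)
definition C2_c :: "(real ^ 'n::finite) set \<Rightarrow> (real ^ 'n \<Rightarrow> real) set" where
  "C2_c U = {\<phi>. Ck_on 2 \<phi> U \<and> compact (closure {x. \<phi> x \<noteq> 0}) \<and> closure {x. \<phi> x \<noteq> 0} \<subseteq> U}"

definition L1_weight ::
    "(real ^ 'n::finite) set \<Rightarrow> (real ^ 'n \<Rightarrow> ennreal) \<Rightarrow> (real ^ 'n \<Rightarrow> real) set" where
  "L1_weight \<Omega> V = {g \<in> borel_measurable (lebesgue_on \<Omega>).
     (\<integral>\<^sup>+ x. ennreal \<bar>g x\<bar> * V x \<partial>lebesgue_on \<Omega>) < \<infinity>}"

definition L1_0 :: "(real ^ 'n::finite) set \<Rightarrow> (real ^ 'n \<Rightarrow> real) set" where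
  "L1_0 \<Omega> = {g. integrable (lebesgue_on \<Omega>) g \<and>
     ((\<lambda>\<epsilon>. 1 / \<epsilon> * (LINT x|lebesgue_on {x \<in> \<Omega>. infdist x (frontier \<Omega>) \<le> \<epsilon>}. \<bar>g x\<bar>))
        \<longlongrightarrow> 0) (at_right 0)}"

(* In integrals of real functions V is replaced by enn2real V, which sends infinity to 0. This
   loses nothing: g in L^1(V) vanishes almost everywhere on {V = infinity}, where the integrands
   are 0 by the convention 0 * infinity = 0. *)
definition weakly_converges ::
    "(real ^ 'n::finite) set \<Rightarrow> (real ^ 'n \<Rightarrow> ennreal) \<Rightarrow>
     (nat \<Rightarrow> real ^ 'n \<Rightarrow> real) \<Rightarrow> (real ^ 'n \<Rightarrow> real) \<Rightarrow> bool" where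
  "weakly_converges \<Omega> V \<phi> \<psi> \<longleftrightarrow>
     (\<forall>j. \<phi> j \<in> C2_0 \<Omega>) \<and> \<psi> \<in> C2_0 \<Omega> \<and>
     (\<forall>g \<in> L1_weight \<Omega> V \<inter> L1_0 \<Omega>.
        (\<lambda>j. LINT x|lebesgue_on \<Omega>. g x * \<phi> j x * enn2real (V x))
          \<longlonglongrightarrow> (LINT x|lebesgue_on \<Omega>. g x * \<psi> x * enn2real (V x)) \<and>
        (\<forall>k. (\<lambda>j. LINT x|lebesgue_on \<Omega>. g x * partial_deriv k (\<phi> j) x)
          \<longlonglongrightarrow> (LINT x|lebesgue_on \<Omega>. g x * partial_deriv k \<psi> x)) \<and>
        (\<lambda>j. LINT x|lebesgue_on \<Omega>. g x * laplacian (\<phi> j) x)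
          \<longlonglongrightarrow> (LINT x|lebesgue_on \<Omega>. g x * laplacian \<psi> x))"

definition weakly_dense ::
    "(real ^ 'n::finite) set \<Rightarrow> (real ^ 'n \<Rightarrow> ennreal) \<Rightarrow> (real ^ 'n \<Rightarrow> real) set \<Rightarrow> bool" where
  "weakly_dense \<Omega> V D \<longleftrightarrow>
     (\<forall>\<psi> \<in> C2_0 \<Omega>. \<exists>\<phi>. (\<forall>j. \<phi> j \<in> D) \<and> weakly_converges \<Omega> V \<phi> \<psi>)"

end

theory Submission
  imports Defs
begin

text \<open>
  The map \<open>\<phi> \<mapsto> \<integral> w (- \<Delta>\<phi> + V \<phi>)\<close> is sequentially continuous for weak convergence in the sense
  of \<open>V\<close>: taking the test function \<open>g = w\<close>, such convergence gives the limits of \<open>\<integral> w \<Delta>\<phi>\<close> and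
  of \<open>\<integral> w \<phi> V\<close>. As the map vanishes on a weakly dense set, it vanishes on all of
  \<open>C\<^sup>2\<^sub>0\<close>.

  What needs an argument is that the integral splits into these two terms, since the Bochner
  integral is additive only for integrable functions. For \<open>\<phi> \<in> C\<^sup>2\<^sub>0\<close> both \<open>\<phi>\<close> and \<open>\<Delta>\<phi>\<close> agree
  on \<open>\<Omega>\<close> with continuous functions on the compact set \<open>closure \<Omega>\<close>, hence are measurable and
  bounded there, while \<open>w\<close> and \<open>w V\<close> are integrable; this gives the integrability of both products
  (lemma \<open>integrable_mult_extends_continuously\<close>) and thereby the splitting
  (lemma \<open>C2_0_integral_split\<close>).
\<close>

lemma extends_continuously_sum:
  assumes "finite I" "\<And>i. i \<in> I \<Longrightarrow> extends_continuously \<Omega> (f i)"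
  shows "extends_continuously \<Omega> (\<lambda>x. \<Sum>i\<in>I. f i x)"
proof -
  obtain h where "\<And>i. i \<in> I \<Longrightarrow> continuous_on (closure \<Omega>) (h i) \<and> (\<forall>x\<in>\<Omega>. h i x = f i x)"
    using assms(2) unfolding extends_continuously_def by metis
  then show ?thesis
    unfolding extends_continuously_def
    by (intro exI[of _ "\<lambda>x. \<Sum>i\<in>I. h i x"]) (auto intro!: continuous_on_sum)
qed

lemma integrable_mult_extends_continuously:
  fixes \<Omega> :: "(real ^ 'n::finite) set" and u f :: "real ^ 'n \<Rightarrow> real"
  assumes "open \<Omega>" "bounded \<Omega>"
    and u: "integrable (lebesgue_on \<Omega>) u"
    and f: "extends_continuously \<Omega> f"
  shows "integrable (lebesgue_on \<Omega>) (\<lambda>x. u x * f x)"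
proof -
  obtain h where h: "continuous_on (closure \<Omega>) h" "\<And>x. x \<in> \<Omega> \<Longrightarrow> h x = f x"
    using f unfolding extends_continuously_def by blast
  have "continuous_on \<Omega> f"
    using h closure_subset continuous_on_subset by (metis continuous_on_cong)
  then have meas: "f \<in> borel_measurable (lebesgue_on \<Omega>)"
    using \<open>open \<Omega>\<close> by (intro continuous_imp_measurable_on_sets_lebesgue) auto
  have "compact (h ` closure \<Omega>)"
    using h(1) \<open>bounded \<Omega>\<close> by (intro compact_continuous_image) auto
  then have "bounded (h ` closure \<Omega>)"
    by (rule compact_imp_bounded)
  then obtain B where B: "\<forall>x\<in>closure \<Omega>. \<bar>h x\<bar> \<le> B"
    by (auto simp: bounded_iff)
  have bound: "\<bar>f x\<bar> \<le> B" if "x \<in> \<Omega>" for x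
    using B h(2)[OF that] that closure_subset by fastforce
  show ?thesis
  proof (rule Bochner_Integration.integrable_bound)
    show "integrable (lebesgue_on \<Omega>) (\<lambda>x. B * u x)"
      using u by simp
    show "(\<lambda>x. u x * f x) \<in> borel_measurable (lebesgue_on \<Omega>)"
      using u meas by measurable
    show "AE x in lebesgue_on \<Omega>. norm (u x * f x) \<le> norm (B * u x)"
    proof (rule AE_I2)
      fix x assume "x \<in> space (lebesgue_on \<Omega>)"
      then have "\<bar>f x\<bar> \<le> \<bar>B\<bar>"
        using bound[of x] by simp
      then show "norm (u x * f x) \<le> norm (B * u x)"
        by (simp add: abs_mult mult.commute mult_right_mono)
    qed
  qed
qed

text \<open>
  Domination by \<open>\<bar>g\<bar> V\<close>: the inequality \<open>enn2real V \<le> V\<close> holds even where \<open>V = \<infinity>\<close>, as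
  \<open>enn2real\<close> is \<open>0\<close> there.
\<close>

lemma L1_weight_integrable:
  assumes V: "V \<in> borel_measurable (lebesgue_on \<Omega>)" and g: "g \<in> L1_weight \<Omega> V"
  shows "integrable (lebesgue_on \<Omega>) (\<lambda>x. g x * enn2real (V x))"
proof (rule integrableI_bounded)
  have [measurable]: "g \<in> borel_measurable (lebesgue_on \<Omega>)"
    using g by (simp add: L1_weight_def)
  note V[measurable]
  show "(\<lambda>x. g x * enn2real (V x)) \<in> borel_measurable (lebesgue_on \<Omega>)"
    by measurable
  have "ennreal (norm (g x * enn2real (V x))) \<le> ennreal \<bar>g x\<bar> * V x" for x
    by (auto simp: abs_mult ennreal_mult ennreal_enn2real_if intro!: mult_left_mono)
  then have "(\<integral>\<^sup>+ x. ennreal (norm (g x * enn2real (V x))) \<partial>lebesgue_on \<Omega>)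
      \<le> (\<integral>\<^sup>+ x. ennreal \<bar>g x\<bar> * V x \<partial>lebesgue_on \<Omega>)"
    by (intro nn_integral_mono)
  also have "\<dots> < \<infinity>"
    using g by (simp add: L1_weight_def)
  finally show "(\<integral>\<^sup>+ x. ennreal (norm (g x * enn2real (V x))) \<partial>lebesgue_on \<Omega>) < \<infinity>" .
qed

lemma C2_0_extends_continuously:
  assumes "\<phi> \<in> C2_0 \<Omega>"
  shows "extends_continuously \<Omega> \<phi>" "extends_continuously \<Omega> (laplacian \<phi>)"
proof -
  show "extends_continuously \<Omega> \<phi>"
    using assms unfolding C2_0_def C2_closure_def extends_continuously_def by auto
  have "extends_continuously \<Omega> (\<lambda>x. \<Sum>k\<in>UNIV. partial_deriv k (partial_deriv k \<phi>) x)"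
    using assms by (intro extends_continuously_sum) (auto simp: C2_0_def C2_closure_def)
  then show "extends_continuously \<Omega> (laplacian \<phi>)"
    by (simp add: laplacian_def[abs_def])
qed

lemma C2_0_integral_split:
  fixes \<Omega> :: "(real ^ 'n::finite) set"
  assumes "open \<Omega>" "bounded \<Omega>" "V \<in> borel_measurable (lebesgue_on \<Omega>)"
    and w: "w \<in> L1_weight \<Omega> V \<inter> L1_0 \<Omega>"
    and \<phi>: "\<phi> \<in> C2_0 \<Omega>"
  shows "(LINT x|lebesgue_on \<Omega>. w x * (- laplacian \<phi> x + enn2real (V x) * \<phi> x)) =
    (LINT x|lebesgue_on \<Omega>. w x * \<phi> x * enn2real (V x))
      - (LINT x|lebesgue_on \<Omega>. w x * laplacian \<phi> x)"
proof -
  have "integrable (lebesgue_on \<Omega>) w"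
    using w by (simp add: L1_0_def)
  then have lap: "integrable (lebesgue_on \<Omega>) (\<lambda>x. w x * laplacian \<phi> x)"
    using assms C2_0_extends_continuously(2)[OF \<phi>]
    by (intro integrable_mult_extends_continuously)
  have "integrable (lebesgue_on \<Omega>) (\<lambda>x. w x * enn2real (V x) * \<phi> x)"
    using assms C2_0_extends_continuously(1)[OF \<phi>]
    by (intro integrable_mult_extends_continuously L1_weight_integrable) auto
  then have pot: "integrable (lebesgue_on \<Omega>) (\<lambda>x. w x * \<phi> x * enn2real (V x))"
    by (simp add: ac_simps)
  show ?thesis
    unfolding Bochner_Integration.integral_diff[OF pot lap, symmetric]
    by (simp add: algebra_simps)
qed

theorem theorem7:
  fixes \<Omega> K :: "(real ^ 'n::finite) set"
    and V :: "real ^ 'n \<Rightarrow> ennreal"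
    and w :: "real ^ 'n \<Rightarrow> real"
  assumes "smooth_bounded_domain \<Omega>"
    and "potential \<Omega> V"
    and "compact K" and "K \<subseteq> \<Omega>"
    and "weakly_dense \<Omega> V (C2_c (\<Omega> - K))"
    and "w \<in> L1_weight \<Omega> V \<inter> L1_0 \<Omega>"
    and "\<And>\<phi>. \<phi> \<in> C2_c (\<Omega> - K) \<Longrightarrow>
           (LINT x|lebesgue_on \<Omega>. w x * (- laplacian \<phi> x + enn2real (V x) * \<phi> x)) = 0"
  shows "\<forall>\<phi> \<in> C2_0 \<Omega>.
           (LINT x|lebesgue_on \<Omega>. w x * (- laplacian \<phi> x + enn2real (V x) * \<phi> x)) = 0"
proof
  fix \<phi> assume \<phi>: "\<phi> \<in> C2_0 \<Omega>"
  let ?M = "lebesgue_on \<Omega>"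
  let ?I = "\<lambda>\<psi>. LINT x|?M. w x * (- laplacian \<psi> x + enn2real (V x) * \<psi> x)"
  let ?P = "\<lambda>\<psi>. LINT x|?M. w x * \<psi> x * enn2real (V x)"
  let ?L = "\<lambda>\<psi>. LINT x|?M. w x * laplacian \<psi> x"
  have "open \<Omega>" "bounded \<Omega>"
    using assms(1) by (auto simp: smooth_bounded_domain_def)
  moreover have "V \<in> borel_measurable ?M"
    using assms(2) by (simp add: potential_def)
  ultimately have split: "?I \<psi> = ?P \<psi> - ?L \<psi>" if "\<psi> \<in> C2_0 \<Omega>" for \<psi>
    using C2_0_integral_split assms(6) that by blast
  obtain \<psi> where \<psi>: "\<And>j. \<psi> j \<in> C2_c (\<Omega> - K)" and conv: "weakly_converges \<Omega> V \<psi> \<phi>"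
    using assms(5) \<phi> unfolding weakly_dense_def by blast
  have "(\<lambda>j. ?P (\<psi> j)) \<longlonglongrightarrow> ?P \<phi>" "(\<lambda>j. ?L (\<psi> j)) \<longlonglongrightarrow> ?L \<phi>"
    using conv assms(6) unfolding weakly_converges_def by blast+
  then have "(\<lambda>j. ?P (\<psi> j) - ?L (\<psi> j)) \<longlonglongrightarrow> ?P \<phi> - ?L \<phi>"
    by (rule tendsto_diff)
  moreover have "?P (\<psi> j) - ?L (\<psi> j) = 0" for j
    \<comment> \<open>The splitting applies to \<open>\<psi> j\<close> because weak convergence places the sequence in \<open>C2_0 \<Omega>\<close>.\<close>
    using split[of "\<psi> j"] assms(7)[OF \<psi>[of j]] conv unfolding weakly_converges_def by simp
  ultimately have "?P \<phi> - ?L \<phi> = 0"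
    by (simp add: LIMSEQ_const_iff)
  then show "?I \<phi> = 0"
    using split[OF \<phi>] by simp
qed

end
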